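(* Let $\mathbb{F}$ be a field of positive characteristic, and let $R$ be an associative $\mathbb{F}$-algebra with $R=R_1+R_2$, where $R_1,R_2$ are subalgebras of $R$ that are PI-algebras. Let $R_1$ and $R_2$ satisfy the symmetric identities of degrees $d_1$ and $d_2$, respectively, let $k>0$ be an integer, and assume that $(R_1R_2)^k$ is a subset of $R_i$ for $i=1$ or $i=2$. Then, for this $i$, $R$ satisfies the symmetric identity of degree $$D=(d_1+d_2-2)(k d_i+2).$$
   Context: Algebras are associative and need not have a unity. $R=R_1+R_2$ means that every element of $R$ is of the form $r_1+r_2$ with $r_1\in R_1$, $r_2\in R_2$ (the sum need not be direct). A PI-algebra is an algebra satisfying a non-zero polynomial identity with coefficients in $\mathbb{F}$ in non-commuting variables. The symmetric polynomial of degree $d$ is $s_d(x_1,\ldots,x_d)=\sum_{\sigma\in S_d}x_{\sigma(1)}\cdots x_{\sigma(d)}$ in non-commuting variables, where $S_d$ is the symmetric group on $d$ letters. An algebra $A$ satisfies the symmetric identity of degree $d$ if $s_d(a_1,\ldots,a_d)=0$ for all $a_1,\ldots,a_d\in A$. For subsets $A,B$ of an algebra, $(AB)^k$ denotes the set of all products $a_1b_1a_2b_2\cdots a_kb_k$ with $a_j\in A$, $b_j\in B$. *)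

theory Defs
  imports
    Complex_Main
    "HOL-Library.Poly_Mapping"
    "HOL-Combinatorics.Permutations"
begin

locale assoc_algebra = vector_space scale
  for scale :: "'f::field \<Rightarrow> 'r::ring \<Rightarrow> 'r" +
  assumes scale_mult_left: "scale c x * y = scale c (x * y)"
    and scale_mult_right: "x * scale c y = scale c (x * y)"

definition subalgebra :: "('f::field \<Rightarrow> 'r::ring \<Rightarrow> 'r) \<Rightarrow> 'r set \<Rightarrow> bool" where
  "subalgebra scale A \<longleftrightarrow> module.subspace scale A \<and> (\<forall>x\<in>A. \<forall>y\<in>A. x * y \<in> A)"

text \<open>Without a unity the empty product has no meaning; the value 0 is a placeholder.\<close>

fun word_prod :: "'r::ring list \<Rightarrow> 'r" where
  "word_prod [] = 0"
| "word_prod [x] = x"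
| "word_prod (x # y # xs) = x * word_prod (y # xs)"

text \<open>
  Polynomials in the non-commuting variables \<open>0, 1, 2, \<dots>\<close>: a monomial is the list of its
  variables, a polynomial a finitely supported family of coefficients.
\<close>

type_synonym 'f nc_poly = "nat list \<Rightarrow>\<^sub>0 'f"

definition nc_eval ::
  "('f::field \<Rightarrow> 'r::ring \<Rightarrow> 'r) \<Rightarrow> 'f nc_poly \<Rightarrow> (nat \<Rightarrow> 'r) \<Rightarrow> 'r" where
  "nc_eval scale p x =
     (\<Sum>w\<in>Poly_Mapping.keys p. scale (Poly_Mapping.lookup p w) (word_prod (map x w)))"

definition satisfies_identity ::
  "('f::field \<Rightarrow> 'r::ring \<Rightarrow> 'r) \<Rightarrow> 'r set \<Rightarrow> 'f nc_poly \<Rightarrow> bool" where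
  "satisfies_identity scale A p \<longleftrightarrow> (\<forall>x. (\<forall>i. x i \<in> A) \<longrightarrow> nc_eval scale p x = 0)"

text \<open>
  Identities of algebras without unity have no constant term, i.e. the coefficient of the empty
  word is 0; otherwise every algebra would satisfy the constant polynomial 1 under the
  convention for \<^const>\<open>word_prod\<close>.
\<close>

definition PI_algebra :: "('f::field \<Rightarrow> 'r::ring \<Rightarrow> 'r) \<Rightarrow> 'r set \<Rightarrow> bool" where
  "PI_algebra scale A \<longleftrightarrow>
     (\<exists>p. p \<noteq> 0 \<and> Poly_Mapping.lookup p [] = 0 \<and> satisfies_identity scale A p)"

definition sym_poly :: "nat \<Rightarrow> 'f::field nc_poly" where
  "sym_poly d = (\<Sum>\<sigma> | \<sigma> permutes {..<d}. Poly_Mapping.single (map \<sigma> [0..<d]) 1)"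

text \<open>
  Meant for \<open>d > 0\<close>. The polynomial \<open>sym_poly 0\<close> is the constant 1, which has no value in an
  algebra without unity; with the placeholder value of the empty product the identity of degree 0
  holds vacuously.
\<close>

definition satisfies_sym_identity ::
  "('f::field \<Rightarrow> 'r::ring \<Rightarrow> 'r) \<Rightarrow> 'r set \<Rightarrow> nat \<Rightarrow> bool" where
  "satisfies_sym_identity scale A d \<longleftrightarrow> satisfies_identity scale A (sym_poly d)"

lemma satisfies_sym_identity_iff:
  fixes scale :: "'f::field \<Rightarrow> 'r::ring \<Rightarrow> 'r"
  assumes "assoc_algebra scale" "A \<noteq> {}"
  shows "satisfies_sym_identity scale A d \<longleftrightarrow>
    (\<forall>a. (\<forall>i<d. a i \<in> A) \<longrightarrow>
      (\<Sum>\<sigma> | \<sigma> permutes {..<d}. word_prod (map (\<lambda>j. a (\<sigma> j)) [0..<d])) = 0)"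
proof -
  interpret assoc_algebra scale by fact
  let ?P = "{\<sigma>. \<sigma> permutes {..<d}}"
  let ?W = "\<lambda>\<sigma>::nat \<Rightarrow> nat. map \<sigma> [0..<d]"
  have inj: "inj_on ?W ?P"
  proof (rule inj_onI)
    fix \<sigma> \<tau> assume "\<sigma> \<in> ?P" "\<tau> \<in> ?P" "?W \<sigma> = ?W \<tau>"
    then show "\<sigma> = \<tau>"
      by (auto simp: permutes_def fun_eq_iff)
  qed
  have fin: "finite ?P" by (simp add: finite_permutations)
  have lk: "Poly_Mapping.lookup (sym_poly d :: 'f nc_poly) w = (if w \<in> ?W ` ?P then 1 else 0)" for w
  proof (cases "w \<in> ?W ` ?P")
    case True
    then obtain \<tau> where t: "\<tau> \<in> ?P" "w = ?W \<tau>" by blast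
    have "Poly_Mapping.lookup (sym_poly d :: 'f nc_poly) w = (\<Sum>\<sigma>\<in>?P. if \<sigma> = \<tau> then 1 else 0)"
      unfolding sym_poly_def lookup_sum lookup_single t(2) when_def
      using inj t(1) by (intro sum.cong) (auto dest: inj_onD)
    also have "\<dots> = 1" using t(1) fin by simp
    finally show ?thesis using True by simp
  next
    case False
    then show ?thesis
      unfolding sym_poly_def lookup_sum lookup_single
      by (auto simp: when_def intro!: sum.neutral)
  qed
  have keys: "Poly_Mapping.keys (sym_poly d :: 'f nc_poly) = ?W ` ?P"
    by (simp add: set_eq_iff in_keys_iff lk del: mem_Collect_eq)
  have ev: "nc_eval scale (sym_poly d) x = (\<Sum>\<sigma>\<in>?P. word_prod (map (\<lambda>j. x (\<sigma> j)) [0..<d]))" for x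
    unfolding nc_eval_def keys by (simp add: sum.reindex[OF inj] lk o_def)
  have ext: "(\<Sum>\<sigma>\<in>?P. word_prod (map (\<lambda>j. a (\<sigma> j)) [0..<d]))
      = (\<Sum>\<sigma>\<in>?P. word_prod (map (\<lambda>j. b (\<sigma> j)) [0..<d]))"
    if "\<forall>i<d. a i = b i" for a b
  proof (rule sum.cong[OF refl])
    fix \<sigma> assume "\<sigma> \<in> ?P"
    then have "\<forall>j<d. \<sigma> j < d" using permutes_in_image by fastforce
    with that show "word_prod (map (\<lambda>j. a (\<sigma> j)) [0..<d]) = word_prod (map (\<lambda>j. b (\<sigma> j)) [0..<d])"
      by (intro arg_cong[of _ _ word_prod]) auto
  qed
  obtain c where c: "c \<in> A" using assms(2) by blast
  show ?thesis
  proof (intro iffI allI impI)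
    fix a assume s: "satisfies_sym_identity scale A d" and a: "\<forall>i<d. a i \<in> A"
    define b where "b = (\<lambda>i. if i < d then a i else c)"
    have "nc_eval scale (sym_poly d) b = 0"
      using s a c unfolding satisfies_sym_identity_def satisfies_identity_def b_def by auto
    moreover have "\<forall>i<d. a i = b i" by (simp add: b_def)
    ultimately show "(\<Sum>\<sigma>\<in>?P. word_prod (map (\<lambda>j. a (\<sigma> j)) [0..<d])) = 0"
      using ev ext by metis
  qed (auto simp: satisfies_sym_identity_def satisfies_identity_def ev)
qed

text \<open>\<open>(AB)\<^sup>k\<close> is the set of products \<open>a\<^sub>1 b\<^sub>1 \<dots> a\<^sub>k b\<^sub>k\<close>, not their span.\<close>

definition alt_products :: "'r::ring set \<Rightarrow> 'r set \<Rightarrow> nat \<Rightarrow> 'r set" where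
  "alt_products A B k =
     {word_prod (map (\<lambda>j. a j * b j) [0..<k]) | a b. \<forall>j<k. a j \<in> A \<and> b j \<in> B}"

end

(*
By multilinearity every variable may be evaluated at an element of R_1 or of R_2, so each monomial
of s_D becomes a word in letters of two types. Write a word as a prefix of R_2-letters followed by
maximal segments "R_1-letters, then R_2-letters" and a tail of R_1-letters.

If there are at least k d_i segments, the first k d_i of them form d_i blocks of k segments. The
product over a block lies in (R_1 R_2)^k and hence in R_i. Permuting the d_i blocks yields words
with the same prefix, the same remainder and the same set of blocks, and their sum vanishes by the
identity of degree d_i.

If there are fewer segments, the degree D forces a run of d_1 letters from R_1 or of d_2 letters
from R_2. A run whose position depends only on the pattern of types stays in place when its letters
are permuted, so these words also cancel in groups.
*)

theory Submission
  imports Defs "HOL-Combinatorics.Multiset_Permutations"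
begin

section \<open>Products of words in a ring without unity\<close>

lemma word_prod_Cons: "xs \<noteq> [] \<Longrightarrow> word_prod (x # xs) = x * word_prod xs"
  by (cases xs) auto

lemma word_prod_append:
  "xs \<noteq> [] \<Longrightarrow> ys \<noteq> [] \<Longrightarrow> word_prod (xs @ ys) = word_prod xs * word_prod ys"
  by (induction xs rule: word_prod.induct) (auto simp: word_prod_Cons mult.assoc)

lemma word_prod_concat: "[] \<notin> set cs \<Longrightarrow> word_prod (concat cs) = word_prod (map word_prod cs)"
proof (induction cs)
  case (Cons c cs)
  then show ?case
    by (cases cs) (auto simp: word_prod_append)
qed simp

text \<open>Associativity contracts the middle factor to one letter. Working with lists rather than
  with a product of three ring elements allows \<open>u\<close> and \<open>v\<close> to be
  empty.\<close>

lemma word_prod_collapse: "c \<noteq> [] \<Longrightarrow> word_prod (u @ c @ v) = word_prod (u @ word_prod c # v)"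
proof (induction u)
  case Nil
  then show ?case by (cases v) (auto simp: word_prod_append)
qed (auto simp: word_prod_Cons)

text \<open>The form \<open>additive\<close> gives access to the library facts on zero and finite
  sums, which move a whole symmetric sum into a single letter of a word.\<close>

lemma additive_word_prod: "additive (\<lambda>x. word_prod (u @ x # v))"
proof
  show "word_prod (u @ (x + y) # v) = word_prod (u @ x # v) + word_prod (u @ y # v)" for x y
  proof (induction u)
    case Nil
    then show ?case by (cases v) (auto simp: distrib_right)
  qed (auto simp: word_prod_Cons distrib_left)
qed

lemma word_prod_closed:
  assumes "\<forall>x\<in>A. \<forall>y\<in>A. x * y \<in> A" "xs \<noteq> []" "set xs \<subseteq> A"
  shows "word_prod xs \<in> A"
  using assms(2,3) by (induction xs rule: word_prod.induct) (auto intro: assms(1)[rule_format])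

section \<open>Values of symmetric polynomials\<close>

text \<open>The value of the symmetric polynomial of degree \<open>card X\<close> for finite
  \<open>X\<close>. The variables are indexed by an arbitrary set, so that chunks of a word can
  later serve as variables themselves.\<close>

definition sym_sum :: "('x \<Rightarrow> 'r::ring) \<Rightarrow> 'x set \<Rightarrow> 'r" where
  "sym_sum f X = (\<Sum>w\<in>permutations_of_set X. word_prod (map f w))"

lemma sym_sum_image:
  assumes "inj_on h X"
  shows "sym_sum f (h ` X) = sym_sum (f \<circ> h) X"
proof -
  have "inj_on (map h) (permutations_of_set X)"
    using assms by (intro inj_on_mapI) (auto simp: permutations_of_set_def inj_on_def)
  then show ?thesis
    unfolding sym_sum_def permutations_of_set_image_inj[OF assms] by (simp add: sum.reindex)
qed

text \<open>Listing the values of a permutation embeds the permutations of \<open>{..<n}\<close>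
  into the orderings of that set, and both sets have \<open>n!\<close> elements.\<close>

lemma sum_permutes_eq_sym_sum:
  "(\<Sum>\<sigma> | \<sigma> permutes {..<n}. word_prod (map (\<lambda>j. a (\<sigma> j)) [0..<n])) = sym_sum a {..<n}"
proof -
  let ?P = "{\<sigma>. \<sigma> permutes {..<n}}" and ?W = "\<lambda>\<sigma>::nat \<Rightarrow> nat. map \<sigma> [0..<n]"
  have inj: "inj_on ?W ?P"
  proof (rule inj_onI)
    fix \<sigma> \<tau> assume "\<sigma> \<in> ?P" "\<tau> \<in> ?P" "?W \<sigma> = ?W \<tau>"
    then show "\<sigma> = \<tau>"
      by (auto simp: permutes_def fun_eq_iff)
  qed
  have "?W ` ?P \<subseteq> permutations_of_set {..<n}"
    by (auto simp: permutations_of_set_def permutes_image distinct_map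
        simp flip: lessThan_atLeast0 intro: permutes_inj_on)
  then have "?W ` ?P = permutations_of_set {..<n}"
    by (intro card_subset_eq) (simp_all add: card_image[OF inj] card_permutations)
  then show ?thesis
    using sum.reindex[OF inj, of "\<lambda>w. word_prod (map a w)"] by (simp add: sym_sum_def o_def)
qed

lemma satisfies_sym_identity_iff_sym_sum:
  fixes scale :: "'f::field \<Rightarrow> 'r::ring \<Rightarrow> 'r"
  assumes "assoc_algebra scale" "A \<noteq> {}"
  shows "satisfies_sym_identity scale A n \<longleftrightarrow> (\<forall>a. (\<forall>i<n. a i \<in> A) \<longrightarrow> sym_sum a {..<n} = 0)"
  unfolding satisfies_sym_identity_iff[OF assms] sum_permutes_eq_sym_sum ..

lemma sym_sum_eq_0:
  fixes scale :: "'f::field \<Rightarrow> 'r::ring \<Rightarrow> 'r"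
  assumes "assoc_algebra scale" "A \<noteq> {}" "satisfies_sym_identity scale A (card X)"
    and "finite X" "f ` X \<subseteq> A"
  shows "sym_sum f X = 0"
proof -
  obtain h where h: "bij_betw h {..<card X} X"
    using ex_bij_betw_nat_finite[OF assms(4)] by (auto simp: lessThan_atLeast0)
  then have X: "inj_on h {..<card X}" "X = h ` {..<card X}"
    by (auto simp: bij_betw_def)
  have "\<forall>i<card X. (f \<circ> h) i \<in> A"
    using X(2) assms(5) by auto
  then have "sym_sum (f \<circ> h) {..<card X} = 0"
    using assms(3) unfolding satisfies_sym_identity_iff_sym_sum[OF assms(1,2)] by blast
  then show ?thesis
    using sym_sum_image[OF X(1), of f] X(2) by simp
qed

text \<open>Every ordering of \<open>X\<close> contains \<open>y\<close> exactly once, so each word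
  is additive in the value at \<open>y\<close>.\<close>

lemma sym_sum_multilinear:
  fixes f :: "'x \<Rightarrow> 'r::ring"
  assumes "y \<in> X"
  shows "sym_sum (f(y := a + b)) X = sym_sum (f(y := a)) X + sym_sum (f(y := b)) X"
proof -
  have "word_prod (map (f(y := a + b)) w) = word_prod (map (f(y := a)) w) + word_prod (map (f(y := b)) w)"
    if w: "w \<in> permutations_of_set X" for w
  proof -
    obtain u v where uv: "w = u @ y # v"
      using w assms by (metis permutations_of_setD(1) split_list)
    with w have "y \<notin> set u" "y \<notin> set v"
      by (auto dest: permutations_of_setD)
    then have "map (f(y := c)) w = map f u @ c # map f v" for c
      by (simp add: uv map_fun_upd)
    then show ?thesis
      by (simp add: additive.add[OF additive_word_prod])
  qed
  then show ?thesis
    by (simp add: sym_sum_def sum.distrib)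
qed

lemma sym_sum_eq_0_if_spanning:
  fixes f :: "'x \<Rightarrow> 'r::ring" and A B :: "'r set"
  assumes "finite X" "\<And>r. \<exists>a\<in>A. \<exists>b\<in>B. r = a + b"
    and zero: "\<And>g. \<forall>x\<in>X. g x \<in> A \<union> B \<Longrightarrow> sym_sum g X = 0"
  shows "sym_sum f X = 0"
proof -
  \<comment> \<open>Induction on the set \<open>Y\<close> of variables whose values may still lie
    outside \<open>A \<union> B\<close>; each step splits the value of one variable.\<close>
  have "sym_sum g X = 0" if "finite Y" "Y \<subseteq> X" "\<forall>x\<in>X - Y. g x \<in> A \<union> B"
    for g :: "'x \<Rightarrow> 'r" and Y
    using that
  proof (induction Y arbitrary: g rule: finite_induct)
    case empty
    then show ?case using zero by simp
  next
    case (insert y Y)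
    obtain a b where ab: "a \<in> A" "b \<in> B" "g y = a + b"
      using assms(2) by blast
    have "sym_sum (g(y := c)) X = 0" if "c \<in> A \<union> B" for c
      using insert.prems that by (intro insert.IH) auto
    then have "sym_sum (g(y := a + b)) X = 0"
      using ab insert.prems by (subst sym_sum_multilinear) auto
    then show ?case
      by (simp flip: ab(3))
  qed
  from this[OF assms(1), of f] show ?thesis by simp
qed

section \<open>Cancellation of words in classes\<close>

text \<open>
  The cancellation scheme: \<open>Dec w u cs v\<close> splits \<open>w\<close> into chunks \<open>cs\<close> between \<open>u\<close> and \<open>v\<close> in
  a way that survives permutation of the chunks, so \<open>W\<close> falls into classes with common
  \<open>(u, set cs, v)\<close>, and each class sums to \<open>u \<cdot> s(cs) \<cdot> v\<close>.
\<close>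

lemma sum_words_eq_0:
  fixes f :: "'x \<Rightarrow> 'r::ring" and Dec :: "'x list \<Rightarrow> 'x list \<Rightarrow> 'x list list \<Rightarrow> 'x list \<Rightarrow> bool"
  assumes fin: "finite W"
    and ex: "\<And>w. w \<in> W \<Longrightarrow> \<exists>u cs v. Dec w u cs v"
    and uniq: "\<And>w u cs v u' cs' v'. Dec w u cs v \<Longrightarrow> Dec w u' cs' v' \<Longrightarrow> u = u' \<and> cs = cs' \<and> v = v'"
    and dec: "\<And>w u cs v. w \<in> W \<Longrightarrow> Dec w u cs v \<Longrightarrow>
      w = u @ concat cs @ v \<and> distinct cs \<and> cs \<noteq> [] \<and> [] \<notin> set cs"
    and perm: "\<And>w u cs v cs'. w \<in> W \<Longrightarrow> Dec w u cs v \<Longrightarrow> cs' \<in> permutations_of_set (set cs) \<Longrightarrow>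
      u @ concat cs' @ v \<in> W \<and> Dec (u @ concat cs' @ v) u cs' v"
    and zero: "\<And>w u cs v. w \<in> W \<Longrightarrow> Dec w u cs v \<Longrightarrow> sym_sum (word_prod \<circ> map f) (set cs) = 0"
  shows "(\<Sum>w\<in>W. word_prod (map f w)) = 0"
proof -
  \<comment> \<open>The invariant of a class: the order of the chunks is forgotten. It is well
    defined because \<open>Dec\<close> determines \<open>u\<close>, \<open>cs\<close> and
    \<open>v\<close>.\<close>
  define key where "key w = (THE K. \<exists>u cs v. Dec w u cs v \<and> K = (u, set cs, v))" for w
  have key: "key w = (u, set cs, v)" if "Dec w u cs v" for w u cs v
    unfolding key_def using that uniq by (intro the_equality) blast+
  have "(\<Sum>w\<in>{w\<in>W. key w = K}. word_prod (map f w)) = 0" if K: "K \<in> key ` W" for K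
  proof -
    obtain w u cs v where w: "w \<in> W" "K = key w" "Dec w u cs v"
      using K ex by fastforce
    let ?P = "permutations_of_set (set cs)" and ?h = "\<lambda>cs'. u @ concat cs' @ v"
    have K: "K = (u, set cs, v)"
      using w key by simp
    have "{w \<in> W. key w = K} = ?h ` ?P"
    proof (intro equalityI subsetI)
      fix w' assume "w' \<in> {w \<in> W. key w = K}"
      then have w': "w' \<in> W" "key w' = K"
        by auto
      then obtain u' cs' v' where d: "Dec w' u' cs' v'"
        using ex by blast
      then have "u' = u" "set cs' = set cs" "v' = v"
        using key[OF d] w' K by auto
      then show "w' \<in> ?h ` ?P"
        using dec[OF w'(1) d] by (auto simp: permutations_of_set_def)
    next
      fix w' assume "w' \<in> ?h ` ?P"
      then obtain cs' where cs': "cs' \<in> ?P" "w' = ?h cs'"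
        by blast
      then have "key w' = (u, set cs', v)"
        using perm[OF w(1,3)] key by blast
      then show "w' \<in> {w \<in> W. key w = K}"
        using perm[OF w(1,3) cs'(1)] cs' K by (auto dest: permutations_of_setD(1))
    qed
    \<comment> \<open>Uniqueness of \<open>Dec\<close> recovers the order of the chunks from the
      word, so the class is counted without repetition.\<close>
    moreover have "inj_on ?h ?P"
    proof (rule inj_onI)
      fix x y assume "x \<in> ?P" "y \<in> ?P" "?h x = ?h y"
      then show "x = y"
        using perm[OF w(1,3)] uniq by metis
    qed
    ultimately have "(\<Sum>w\<in>{w\<in>W. key w = K}. word_prod (map f w)) = (\<Sum>cs'\<in>?P. word_prod (map f (?h cs')))"
      by (simp add: sum.reindex)
    \<comment> \<open>Each chunk is contracted to one letter, and the product of these letters to a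
      single letter between \<open>u\<close> and \<open>v\<close>.\<close>
    also have "\<dots> = (\<Sum>cs'\<in>?P. word_prod (map f u @ word_prod (map (word_prod \<circ> map f) cs') # map f v))"
    proof (rule sum.cong[OF refl])
      fix cs' assume "cs' \<in> ?P"
      then have "set cs' = set cs"
        by (rule permutations_of_setD)
      then have ne: "[] \<notin> set (map (map f) cs')" "cs' \<noteq> []"
        using dec[OF w(1,3)] by auto
      then have "concat (map (map f) cs') \<noteq> []"
        by (cases cs') auto
      then have "word_prod (map f u @ concat (map (map f) cs') @ map f v)
          = word_prod (map f u @ word_prod (concat (map (map f) cs')) # map f v)"
        by (rule word_prod_collapse)
      then show "word_prod (map f (?h cs')) =
          word_prod (map f u @ word_prod (map (word_prod \<circ> map f) cs') # map f v)"
        by (simp add: map_concat word_prod_concat[OF ne(1)])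
    qed
    also have "\<dots> = word_prod (map f u @ sym_sum (word_prod \<circ> map f) (set cs) # map f v)"
      unfolding sym_sum_def by (simp add: additive.sum[OF additive_word_prod])
    also have "\<dots> = 0"
      by (simp add: zero[OF w(1,3)] additive.zero[OF additive_word_prod])
    finally show ?thesis .
  qed
  then show ?thesis
    by (subst sum.image_gen[OF fin, of _ key]) simp
qed

section \<open>Segments, blocks and their unique decoding\<close>

text \<open>The predicate \<open>t\<close> marks the letters from R_1. The product over such a
  segment is one factor \<open>a * b\<close> with \<open>a\<close> in R_1 and \<open>b\<close> in
  R_2.\<close>

definition falling :: "('x \<Rightarrow> bool) \<Rightarrow> 'x list \<Rightarrow> bool" where
  "falling t c \<longleftrightarrow>
     (\<exists>x y. c = x @ y \<and> x \<noteq> [] \<and> y \<noteq> [] \<and> (\<forall>i\<in>set x. t i) \<and> (\<forall>i\<in>set y. \<not> t i))"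

definition block :: "('x \<Rightarrow> bool) \<Rightarrow> nat \<Rightarrow> 'x list \<Rightarrow> bool" where
  "block t k c \<longleftrightarrow> (\<exists>ps. c = concat ps \<and> length ps = k \<and> (\<forall>p\<in>set ps. falling t p))"

text \<open>A remainder of this form cannot lengthen the segment before it, which makes
  decompositions unique.\<close>

definition starts :: "('x \<Rightarrow> bool) \<Rightarrow> 'x list \<Rightarrow> bool" where
  "starts t v \<longleftrightarrow> v = [] \<or> t (hd v)"

definition block_dec ::
  "('x \<Rightarrow> bool) \<Rightarrow> nat \<Rightarrow> nat \<Rightarrow> 'x list \<Rightarrow> 'x list \<Rightarrow> 'x list list \<Rightarrow> 'x list \<Rightarrow> bool" where
  "block_dec t k m w u cs v \<longleftrightarrow> w = u @ concat cs @ v \<and> length cs = m \<and>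
     (\<forall>i\<in>set u. \<not> t i) \<and> (\<forall>c\<in>set cs. block t k c) \<and> starts t v"

text \<open>The segment is read off greedily: all leading letters of type \<open>t\<close>, then all
  following letters not of type \<open>t\<close>. The remainder stops the second run.\<close>

lemma falling_unique:
  assumes "falling t c" "falling t c'" "starts t r" "starts t r'" "c @ r = c' @ r'"
  shows "c = c'"
proof -
  have *: "c = takeWhile t (c @ r) @ takeWhile (\<lambda>i. \<not> t i) (dropWhile t (c @ r))"
    if c: "falling t c" and r: "starts t r" for c r
  proof -
    obtain x y where xy: "c = x @ y" "y \<noteq> []" "\<forall>i\<in>set x. t i" "\<forall>i\<in>set y. \<not> t i"
      using c by (auto simp: falling_def)
    have "takeWhile t (y @ r) = []" "dropWhile t (y @ r) = y @ r"
      using xy(2,4) by (cases y; simp)+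
    moreover have "takeWhile (\<lambda>i. \<not> t i) r = []"
      using r by (cases r) (auto simp: starts_def)
    ultimately show ?thesis
      using xy by (simp add: takeWhile_append2 dropWhile_append2)
  qed
  show ?thesis
    using *[OF assms(1,3)] *[OF assms(2,4)] assms(5) by simp
qed

lemma starts_falling: "falling t c \<Longrightarrow> starts t (c @ r)"
  by (auto simp: falling_def starts_def hd_append)

text \<open>Unique decoding by peeling off one code word at a time; what follows a code word is
  again an admissible remainder. It serves for segments within a block and for blocks within a
  word.\<close>

lemma concat_append_unique:
  assumes code: "\<And>c c' r r'. Q c \<Longrightarrow> Q c' \<Longrightarrow> ok r \<Longrightarrow> ok r' \<Longrightarrow> c @ r = c' @ r' \<Longrightarrow> c = c'"
    and ok: "\<And>c r. Q c \<Longrightarrow> ok (c @ r)"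
  assumes "length cs = length cs'" "\<forall>c\<in>set cs. Q c" "\<forall>c\<in>set cs'. Q c"
    and "ok r" "ok r'" "concat cs @ r = concat cs' @ r'"
  shows "cs = cs' \<and> r = r'"
  using assms(3-)
proof (induction cs cs' rule: list_induct2)
  case (Cons c cs c' cs')
  have "ok (concat xs @ r)" if "\<forall>x\<in>set xs. Q x" "ok r" for xs r
    using that ok by (cases xs) auto
  then have "c = c'"
    using Cons.prems by (intro code[of c c' "concat cs @ r" "concat cs' @ r'"]) auto
  then show ?case
    using Cons by auto
qed simp

lemma block_prefix:
  assumes "block t k c" "k > 0"
  obtains p y where "c = p @ y" "falling t p"
proof -
  obtain ps where "c = concat ps" "length ps = k" "\<forall>p\<in>set ps. falling t p"
    using assms by (auto simp: block_def)
  with assms(2) that show thesis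
    by (cases ps) auto
qed

lemma starts_block: "block t k c \<Longrightarrow> k > 0 \<Longrightarrow> starts t (c @ r)"
  by (elim block_prefix) (auto intro: starts_falling)

lemma block_unique:
  assumes "block t k c" "block t k c'" "starts t r" "starts t r'" "c @ r = c' @ r'"
  shows "c = c'"
proof -
  obtain ps ps' where ps: "c = concat ps" "length ps = k" "\<forall>p\<in>set ps. falling t p"
    and ps': "c' = concat ps'" "length ps' = k" "\<forall>p\<in>set ps'. falling t p"
    using assms(1,2) by (auto simp: block_def)
  have "ps = ps' \<and> r = r'"
    by (rule concat_append_unique[of "falling t" "starts t"])
      (use assms ps ps' in \<open>auto intro: falling_unique starts_falling\<close>)
  with ps ps' show ?thesis by simp
qed

lemma block_nonempty: "block t k c \<Longrightarrow> k > 0 \<Longrightarrow> c \<noteq> []"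
  by (elim block_prefix) (auto simp: falling_def)

lemma block_dec_unique:
  assumes "k > 0" "block_dec t k m w u cs v" "block_dec t k m w u' cs' v'"
  shows "u = u' \<and> cs = cs' \<and> v = v'"
proof -
  have st: "starts t (concat cs @ v)" if "block_dec t k m w u cs v" for u cs v
    using that starts_block[OF _ assms(1)] unfolding block_dec_def by (cases cs) auto
  \<comment> \<open>Non-empty blocks begin with a letter of type \<open>t\<close>, so the prefix is
    the maximal initial run of the other type.\<close>
  have "u = takeWhile (\<lambda>i. \<not> t i) w" if d: "block_dec t k m w u cs v" for u cs v
  proof -
    have "takeWhile (\<lambda>i. \<not> t i) (concat cs @ v) = []"
      using st[OF d] unfolding starts_def by (cases "concat cs @ v") (simp_all del: append_is_Nil_conv)
    then show ?thesis
      using d by (simp add: block_dec_def takeWhile_append2)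
  qed
  then have u: "u = u'"
    using assms(2,3) by metis
  have "cs = cs' \<and> v = v'"
    using assms(2,3) u
    by (intro concat_append_unique[of "block t k" "starts t", OF block_unique starts_block])
      (auto simp: block_dec_def assms(1))
  with u show ?thesis by simp
qed

section \<open>Dependence on the pattern of types alone\<close>

lemma map_eq_map_concat:
  "map t w = map t (concat cs) \<Longrightarrow> \<exists>cs'. w = concat cs' \<and> map (map t) cs' = map (map t) cs"
proof (induction cs arbitrary: w)
  case (Cons c cs)
  then obtain c' w' where w: "w = c' @ w'" "map t c' = map t c" "map t w' = map t (concat cs)"
    by (auto simp: map_eq_append_conv)
  with Cons.IH obtain cs' where "w' = concat cs'" "map (map t) cs' = map (map t) cs"
    by blast
  with w show ?case
    by (intro exI[of _ "c' # cs'"]) auto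
qed auto

lemma ball_set_cong_map:
  assumes "\<And>x y. h x = h y \<Longrightarrow> P x = P y" "map h xs = map h ys"
  shows "(\<forall>x\<in>set xs. P x) \<longleftrightarrow> (\<forall>y\<in>set ys. P y)"
proof -
  have "length xs = length ys" "\<forall>i<length xs. h (xs ! i) = h (ys ! i)"
    using assms(2) by (auto simp: list_eq_iff_nth_eq)
  then show ?thesis
    using assms(1) by (metis in_set_conv_nth)
qed

lemma falling_cong_map:
  assumes "map t c = map t c'"
  shows "falling t c = falling t c'"
proof -
  have "falling t c'" if c: "map t c = map t c'" "falling t c" for c c'
  proof -
    obtain x y where xy: "c = x @ y" "x \<noteq> []" "y \<noteq> []" "\<forall>i\<in>set x. t i" "\<forall>i\<in>set y. \<not> t i"
      using c(2) by (auto simp: falling_def)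
    have "map t c' = map t x @ map t y"
      using c(1) xy(1) by simp
    then obtain x' y' where "c' = x' @ y'" "map t x' = map t x" "map t y' = map t y"
      by (metis map_eq_append_conv)
    moreover from this have "\<forall>i\<in>set x'. t i" "\<forall>i\<in>set y'. \<not> t i"
      using xy(4,5) ball_set_cong_map[of t t x' x] ball_set_cong_map[of t "\<lambda>i. \<not> t i" y' y] by simp_all
    ultimately show ?thesis
      using xy(2,3) unfolding falling_def by (intro exI[of _ x'] exI[of _ y']) auto
  qed
  then show ?thesis
    using assms by metis
qed

lemma block_cong_map:
  assumes "map t c = map t c'"
  shows "block t k c = block t k c'"
proof -
  have "block t k c'" if c: "map t c = map t c'" "block t k c" for c c'
  proof -
    obtain ps where ps: "c = concat ps" "length ps = k" "\<forall>p\<in>set ps. falling t p"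
      using c(2) by (auto simp: block_def)
    then obtain qs where qs: "c' = concat qs" "map (map t) qs = map (map t) ps"
      using map_eq_map_concat[of t c' ps] c(1) by auto
    then have "\<forall>q\<in>set qs. falling t q"
      using ps(3) ball_set_cong_map[of "map t" "falling t", OF falling_cong_map] by blast
    with qs ps(2) show ?thesis
      unfolding block_def by (metis length_map)
  qed
  then show ?thesis
    using assms by metis
qed

text \<open>The cuts of \<open>w\<close> are transferred to \<open>w'\<close> at the same positions.
  Hence the words without a block decomposition are closed under change to a word with the same
  pattern, as the long-run argument requires.\<close>

lemma block_dec_cong_map:
  assumes "map t w = map t w'" "block_dec t k m w u cs v"
  shows "\<exists>u' cs' v'. block_dec t k m w' u' cs' v'"
proof -
  have w: "w = u @ concat cs @ v" and d: "length cs = m" "\<forall>i\<in>set u. \<not> t i"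
    "\<forall>c\<in>set cs. block t k c" "starts t v"
    using assms(2) by (auto simp: block_dec_def)
  have "map t w' = map t u @ map t (concat cs) @ map t v"
    using assms(1) w by simp
  then obtain u' y where y: "w' = u' @ y" "map t u' = map t u" "map t y = map t (concat cs) @ map t v"
    by (metis map_eq_append_conv)
  then obtain c' v' where "y = c' @ v'" "map t c' = map t (concat cs)" "map t v' = map t v"
    by (metis map_eq_append_conv)
  with y have w': "w' = u' @ c' @ v'" "map t u' = map t u"
    "map t c' = map t (concat cs)" "map t v' = map t v"
    by simp_all
  obtain cs' where cs': "c' = concat cs'" "map (map t) cs' = map (map t) cs"
    using map_eq_map_concat[OF w'(3)] by blast
  have "length cs' = m"
    using cs'(2) d(1) by (metis length_map)
  moreover have "\<forall>i\<in>set u'. \<not> t i"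
    using ball_set_cong_map[of t "\<lambda>i. \<not> t i"] w'(2) d(2) by blast
  moreover have "\<forall>c\<in>set cs'. block t k c"
    using ball_set_cong_map[of "map t" "block t k", OF block_cong_map] cs'(2) d(3) by blast
  moreover have "starts t v'"
    using d(4) w'(4) by (cases v; cases v') (auto simp: starts_def)
  ultimately show ?thesis
    using w'(1) cs'(1) unfolding block_dec_def by blast
qed

section \<open>Existence of a block decomposition or of a long run\<close>

text \<open>Letters are added at the front. A letter of type \<open>t\<close> opens a new segment if
  \<open>u\<close> is non-empty, and otherwise extends the first segment or, if there is none, the
  tail \<open>z\<close>.\<close>

lemma falling_decomposition:
  "\<exists>u ps z. w = u @ concat ps @ z \<and> (\<forall>i\<in>set u. \<not> t i) \<and> (\<forall>p\<in>set ps. falling t p) \<and> (\<forall>i\<in>set z. t i)"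
proof (induction w)
  case (Cons x w)
  then obtain u ps z where w: "w = u @ concat ps @ z" "\<forall>i\<in>set u. \<not> t i"
    "\<forall>p\<in>set ps. falling t p" "\<forall>i\<in>set z. t i"
    by blast
  consider "\<not> t x" | "t x" "u \<noteq> []" | "t x" "u = []" "ps = []" | p qs where "t x" "u = []" "ps = p # qs"
    by (cases ps) auto
  then show ?case
  proof cases
    case 1
    with w show ?thesis by (intro exI[of _ "x # u"] exI[of _ ps] exI[of _ z]) auto
  next
    case 2
    with w have "falling t (x # u)"
      unfolding falling_def by (intro exI[of _ "[x]"] exI[of _ u]) auto
    with w show ?thesis by (intro exI[of _ "[]"] exI[of _ "(x # u) # ps"] exI[of _ z]) auto
  next
    case 3
    with w show ?thesis by (intro exI[of _ "[]"] exI[of _ "[]"] exI[of _ "x # z"]) auto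
  next
    case 4
    then obtain a b where "p = a @ b" "b \<noteq> []" "\<forall>i\<in>set a. t i" "\<forall>i\<in>set b. \<not> t i"
      using w(3) by (auto simp: falling_def)
    with 4 have "falling t (x # p)"
      unfolding falling_def by (intro exI[of _ "x # a"] exI[of _ b]) auto
    with w 4 show ?thesis by (intro exI[of _ "[]"] exI[of _ "(x # p) # qs"] exI[of _ z]) auto
  qed
qed (intro exI[of _ "[]"], simp)

lemma concat_group:
  "length ps = m * k \<Longrightarrow> \<exists>cs. length cs = m \<and> concat ps = concat cs \<and>
    (\<forall>c\<in>set cs. \<exists>qs. c = concat qs \<and> length qs = k \<and> set qs \<subseteq> set ps)"
proof (induction m arbitrary: ps)
  case (Suc m)
  then have "length (drop k ps) = m * k"
    by simp
  from Suc.IH[OF this] obtain cs where cs: "length cs = m" "concat (drop k ps) = concat cs"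
    "\<forall>c\<in>set cs. \<exists>qs. c = concat qs \<and> length qs = k \<and> set qs \<subseteq> set (drop k ps)"
    by blast
  have ps: "concat ps = concat (take k ps) @ concat cs"
    by (metis append_take_drop_id concat_append cs(2))
  have tk: "length (take k ps) = k" "set (take k ps) \<subseteq> set ps"
    using Suc.prems by (auto dest: in_set_takeD)
  have "\<exists>qs. c = concat qs \<and> length qs = k \<and> set qs \<subseteq> set ps" if "c \<in> set cs" for c
    using cs(3) that set_drop_subset[of k ps] by (meson order_trans)
  moreover have "\<exists>qs. concat (take k ps) = concat qs \<and> length qs = k \<and> set qs \<subseteq> set ps"
    using tk by blast
  ultimately show ?case
    using cs(1) ps by (intro exI[of _ "concat (take k ps) # cs"]) simp
qed simp

text \<open>
  Without a run of \<open>e s\<close> letters of type \<open>s\<close>, each falling segment, and also the leading run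
  together with the trailing one, has at most \<open>e True + e False - 2\<close> letters.
\<close>

lemma block_dec_or_long_run:
  fixes e :: "bool \<Rightarrow> nat"
  assumes e: "e True > 0" "e False > 0" "e True + e False > 2"
    and len: "length w = (e True + e False - 2) * (k * m + 2)"
    and no_dec: "\<nexists>u cs v. block_dec t k m w u cs v"
  shows "\<exists>p s. take (e s) (drop p (map t w)) = replicate (e s) s"
proof (rule ccontr)
  assume no_run: "\<nexists>p s. take (e s) (drop p (map t w)) = replicate (e s) s"
  have short: "length c < e s" if "w = x @ c @ y" "\<forall>i\<in>set c. t i = s" for x c y s
  proof (rule ccontr)
    assume "\<not> length c < e s"
    then have "take (e s) (drop (length x) (map t w)) = map t (take (e s) c)"
      using that(1) by (simp add: take_map)
    also have "\<dots> = replicate (e s) s"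
      using that(2) \<open>\<not> length c < e s\<close>
      by (intro replicate_eqI) (auto dest: in_set_takeD)
    finally show False
      using no_run by blast
  qed
  obtain u ps z where w: "w = u @ concat ps @ z" "\<forall>i\<in>set u. \<not> t i"
    "\<forall>p\<in>set ps. falling t p" "\<forall>i\<in>set z. t i"
    using falling_decomposition[of w t] by (elim exE conjE)
  let ?c = "e True + e False - 2"
  have "length p \<le> ?c" if p: "p \<in> set ps" for p
  proof -
    obtain x y where xy: "p = x @ y" "\<forall>i\<in>set x. t i" "\<forall>i\<in>set y. \<not> t i"
      using p w(3) by (auto simp: falling_def)
    obtain ps1 ps2 where "ps = ps1 @ p # ps2"
      using p by (meson split_list)
    then have "w = (u @ concat ps1) @ x @ (y @ concat ps2 @ z)"
      "w = (u @ concat ps1 @ x) @ y @ (concat ps2 @ z)"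
      using w(1) xy(1) by simp_all
    from short[OF this(1), of True] short[OF this(2), of False] show ?thesis
      using xy by auto
  qed
  then have "length (concat ps) \<le> length ps * ?c"
    by (induction ps) (auto simp: add_mono)
  moreover have "length u < e False" "length z < e True"
    using short[of "[]" u _ False] short[of "u @ concat ps" z "[]" True] w by auto
  \<comment> \<open>The two outer runs together have at most \<open>?c\<close> letters and count as
    one further segment. Since \<open>?c > 0\<close>, comparison with the given length yields at
    least \<open>k * m + 1\<close> segments.\<close>
  ultimately have "length w \<le> (length ps + 1) * ?c"
    using w(1) by simp
  then have "?c * (k * m + 2) \<le> ?c * (length ps + 1)"
    using len by (simp add: mult.commute)
  then have "k * m + 2 \<le> length ps + 1"
    using e(3) by (simp only: mult_le_cancel1)
  then have n: "m * k \<le> length ps"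
    by (simp add: mult.commute)
  \<comment> \<open>The first \<open>m * k\<close> segments form the blocks. What remains begins
    with another segment or consists of the tail \<open>z\<close>, so it starts with type
    \<open>t\<close> or is empty.\<close>
  let ?ps = "take (m * k) ps" and ?v = "concat (drop (m * k) ps) @ z"
  obtain cs where cs: "length cs = m" "concat ?ps = concat cs"
    "\<forall>c\<in>set cs. \<exists>qs. c = concat qs \<and> length qs = k \<and> set qs \<subseteq> set ?ps"
    using concat_group[of ?ps m k] n by auto
  have "\<forall>c\<in>set cs. block t k c"
    using cs(3) w(3) unfolding block_def by (meson in_set_takeD subsetD)
  moreover have "starts t ?v"
  proof (cases "drop (m * k) ps")
    case Nil
    then show ?thesis using w(4) by (cases z) (auto simp: starts_def)
  next
    case (Cons p qs)
    then have "falling t p"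
      using w(3) by (metis in_set_dropD list.set_intros(1))
    with Cons show ?thesis
      by (simp add: starts_falling)
  qed
  moreover have "w = u @ concat cs @ ?v"
    using w(1) cs(2) by (metis append_assoc append_take_drop_id concat_append)
  ultimately have "block_dec t k m w u cs ?v"
    using cs(1) w(2) by (simp add: block_dec_def)
  with no_dec show False by blast
qed

section \<open>Vanishing of the two groups of words\<close>

text \<open>By closure under products, each of the \<open>k\<close> segments contributes an element
  of \<open>A\<close> times an element of \<open>B\<close>.\<close>

lemma word_prod_block:
  assumes A: "\<forall>x\<in>A. \<forall>y\<in>A. x * y \<in> A" and B: "\<forall>x\<in>B. \<forall>y\<in>B. x * y \<in> B"
    and f: "\<forall>x\<in>set c. f x \<in> (if t x then A else B)" and c: "block t k c"
  shows "word_prod (map f c) \<in> alt_products A B k"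
proof -
  obtain ps where ps: "c = concat ps" "length ps = k" "\<forall>p\<in>set ps. falling t p"
    using c by (auto simp: block_def)
  have "\<exists>a b. a \<in> A \<and> b \<in> B \<and> word_prod (map f p) = a * b" if p: "p \<in> set ps" for p
  proof -
    obtain x y where xy: "p = x @ y" "x \<noteq> []" "y \<noteq> []" "\<forall>i\<in>set x. t i" "\<forall>i\<in>set y. \<not> t i"
      using p ps(3) by (auto simp: falling_def)
    have fp: "\<forall>i\<in>set p. f i \<in> (if t i then A else B)"
      using f ps(1) p by auto
    have "\<forall>i\<in>set x. f i \<in> A" "\<forall>i\<in>set y. f i \<in> B"
      using xy fp by (metis Un_iff set_append)+
    then have "word_prod (map f x) \<in> A" "word_prod (map f y) \<in> B"
      using xy by (intro word_prod_closed[OF A] word_prod_closed[OF B]; auto)+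
    then show ?thesis
      using xy by (auto simp: word_prod_append)
  qed
  then obtain a b where ab: "\<forall>p\<in>set ps. a p \<in> A \<and> b p \<in> B \<and> word_prod (map f p) = a p * b p"
    by metis
  have "word_prod (map f c) = word_prod (map (\<lambda>p. word_prod (map f p)) ps)"
    using ps(1,3) by (simp add: map_concat, subst word_prod_concat) (auto simp: falling_def o_def)
  also have "map (\<lambda>p. word_prod (map f p)) ps = map (\<lambda>j. a (ps ! j) * b (ps ! j)) [0..<k]"
    using ab ps(2) by (intro nth_equalityI) auto
  finally show ?thesis
    using ab ps(2) unfolding alt_products_def mem_Collect_eq
    by (intro exI[of _ "\<lambda>j. a (ps ! j)"] exI[of _ "\<lambda>j. b (ps ! j)"]) auto
qed

text \<open>The chunks of the cancellation scheme are the \<open>m\<close> blocks. Their products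
  lie in \<open>C\<close>, where the symmetric identity of degree \<open>m\<close> holds.\<close>

lemma sum_block_dec_eq_0:
  fixes f :: "'x \<Rightarrow> 'r::ring"
  assumes "finite X" "k > 0" "m > 0"
    and C: "\<And>(Y :: 'x list set) g. finite Y \<Longrightarrow> card Y = m \<Longrightarrow> g ` Y \<subseteq> C \<Longrightarrow> sym_sum g Y = 0"
    and blocks: "\<And>c. set c \<subseteq> X \<Longrightarrow> block t k c \<Longrightarrow> word_prod (map f c) \<in> C"
  shows "(\<Sum>w\<in>{w \<in> permutations_of_set X. \<exists>u cs v. block_dec t k m w u cs v}. word_prod (map f w)) = 0"
proof (rule sum_words_eq_0[where Dec = "block_dec t k m"])
  let ?W = "{w \<in> permutations_of_set X. \<exists>u cs v. block_dec t k m w u cs v}"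
  show "finite ?W"
    by simp
  show "\<exists>u cs v. block_dec t k m w u cs v" if "w \<in> ?W" for w
    using that by blast
  show "u = u' \<and> cs = cs' \<and> v = v'"
    if "block_dec t k m w u cs v" "block_dec t k m w u' cs' v'" for w u cs v u' cs' v'
    using block_dec_unique[OF assms(2)] that .
  fix w u cs v assume w: "w \<in> ?W" and d: "block_dec t k m w u cs v"
  have ne: "[] \<notin> set cs"
    using d block_nonempty[OF _ assms(2)] by (auto simp: block_dec_def)
  have weq: "w = u @ concat cs @ v" and len: "length cs = m"
    using d by (auto simp: block_dec_def)
  have dw: "distinct w" "set w = X"
    using w by (auto dest: permutations_of_setD)
  \<comment> \<open>The letters of \<open>w\<close> are distinct, so non-empty blocks at different
    positions differ.\<close>
  have dcs: "distinct cs"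
    using dw(1) ne unfolding weq by (auto simp: distinct_concat_iff removeAll_id)
  show "w = u @ concat cs @ v \<and> distinct cs \<and> cs \<noteq> [] \<and> [] \<notin> set cs"
    using weq dcs ne len assms(3) by auto
  show "u @ concat cs' @ v \<in> ?W \<and> block_dec t k m (u @ concat cs' @ v) u cs' v"
    if "cs' \<in> permutations_of_set (set cs)" for cs'
  proof -
    have s: "set cs' = set cs" "distinct cs'"
      using that by (auto dest: permutations_of_setD)
    then have m: "mset cs' = mset cs"
      using dcs by (simp add: set_eq_iff_mset_eq_distinct)
    then have "mset (concat cs') = mset (concat cs)"
      by (simp add: mset_concat flip: sum_mset_sum_list)
    then have mw: "mset (u @ concat cs' @ v) = mset w"
      by (simp add: weq)
    then have "u @ concat cs' @ v \<in> permutations_of_set X"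
      using dw by (metis mset_eq_imp_distinct_iff mset_eq_setD permutations_of_setI)
    moreover have "block_dec t k m (u @ concat cs' @ v) u cs' v"
      using d s mset_eq_length[OF m] by (auto simp: block_dec_def)
    ultimately show ?thesis by blast
  qed
  have "\<forall>c\<in>set cs. set c \<subseteq> X \<and> block t k c"
    using d dw(2) weq by (auto simp: block_dec_def)
  then show "sym_sum (word_prod \<circ> map f) (set cs) = 0"
    using blocks len dcs by (intro C) (auto simp: distinct_card)
qed

text \<open>The chunks are the single letters of a run of constant type \<open>s\<close>. Permuting
  them preserves the pattern, hence membership in \<open>W\<close> and the choice of the run, and
  each class vanishes by the identity of degree \<open>e s\<close> on \<open>A s\<close>.\<close>

lemma sum_long_run_eq_0:
  fixes f :: "'x \<Rightarrow> 'r::ring"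
  assumes W: "W \<subseteq> permutations_of_set X"
    and cong: "\<And>w w'. w \<in> W \<Longrightarrow> w' \<in> permutations_of_set X \<Longrightarrow> map t w' = map t w \<Longrightarrow> w' \<in> W"
    and run: "\<And>w. w \<in> W \<Longrightarrow> \<exists>p s. take (e s) (drop p (map t w)) = replicate (e s) s"
    and e: "\<And>s. e s > 0"
    and zero: "\<And>(Y :: 'x list set) g s. finite Y \<Longrightarrow> card Y = e s \<Longrightarrow> g ` Y \<subseteq> A s \<Longrightarrow> sym_sum g Y = 0"
    and f: "\<And>x. x \<in> X \<Longrightarrow> f x \<in> A (t x)"
  shows "(\<Sum>w\<in>W. word_prod (map f w)) = 0"
proof -
  \<comment> \<open>the run is chosen from the pattern \<open>map t w\<close> alone, so permuting its letters does not move it\<close>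
  define sel where "sel \<pi> = (SOME q. take (e (snd q)) (drop (fst q) \<pi>) = replicate (e (snd q)) (snd q))" for \<pi>
  define P where "P w = fst (sel (map t w))" for w
  define N where "N w = e (snd (sel (map t w)))" for w
  define Dec where "Dec w u cs v \<longleftrightarrow> u = take (P w) w \<and>
    cs = map (\<lambda>x. [x]) (take (N w) (drop (P w) w)) \<and> v = drop (P w + N w) w" for w u cs v
  show ?thesis
  proof (rule sum_words_eq_0[where Dec = Dec])
    show "finite W"
      using W finite_subset by fastforce
    show "\<exists>u cs v. Dec w u cs v" for w
      by (auto simp: Dec_def)
    show "u = u' \<and> cs = cs' \<and> v = v'" if "Dec w u cs v" "Dec w u' cs' v'" for w u cs v u' cs' v'
      using that by (auto simp: Dec_def)
    fix w u cs v assume w: "w \<in> W" and d: "Dec w u cs v"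
    define c where "c = take (N w) (drop (P w) w)"
    define s where "s = snd (sel (map t w))"
    have N: "N w = e s"
      by (simp add: N_def s_def)
    have "\<exists>q. take (e (snd q)) (drop (fst q) (map t w)) = replicate (e (snd q)) (snd q)"
      using run[OF w] by auto
    then have "take (e s) (drop (P w) (map t w)) = replicate (e s) s"
      unfolding s_def P_def sel_def by (rule someI_ex)
    then have tc: "map t c = replicate (e s) s"
      by (simp add: c_def N take_map drop_map)
    then have lc: "length c = e s"
      by (metis length_map length_replicate)
    \<comment> \<open>As \<open>e s > 0\<close>, a slice of full length forces the position
      \<open>P w\<close> to lie inside \<open>w\<close>. The prefix then has length exactly
      \<open>P w\<close>, so a permuted word is cut at the same places.\<close>
    then have "P w + e s \<le> length w"
      using e[of s] by (auto simp: c_def N min_def split: if_splits)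
    then have lu: "length (take (P w) w) = P w"
      by simp
    have cs: "cs = map (\<lambda>x. [x]) c" "u = take (P w) w" "v = drop (P w + N w) w"
      using d by (auto simp: Dec_def c_def)
    have weq: "w = u @ c @ v"
      unfolding cs c_def by (metis add.commute append_take_drop_id drop_drop)
    have dw: "distinct w" "set w = X"
      using w W by (auto dest: permutations_of_setD)
    have dc: "distinct c"
      using dw(1) weq by simp
    show "w = u @ concat cs @ v \<and> distinct cs \<and> cs \<noteq> [] \<and> [] \<notin> set cs"
      using weq dc lc e[of s] by (auto simp: cs(1) distinct_map inj_on_def)
    have ts: "\<forall>x\<in>set c. t x = s"
      using tc by (metis in_set_replicate list.set_map imageI)
    show "u @ concat cs' @ v \<in> W \<and> Dec (u @ concat cs' @ v) u cs' v"
      if cs': "cs' \<in> permutations_of_set (set cs)" for cs'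
    proof -
      have "\<forall>y\<in>set cs'. \<exists>x. y = [x]"
        using cs' cs(1) by (auto dest: permutations_of_setD)
      then have cs'_c': "cs' = map (\<lambda>x. [x]) (concat cs')"
        by (induction cs') auto
      define c' where "c' = concat cs'"
      have cs'_c': "cs' = map (\<lambda>x. [x]) c'"
        using cs'_c' by (simp add: c'_def)
      have c': "set c' = set c" "distinct c'"
        using cs' unfolding cs'_c' cs(1) by (auto simp: permutations_of_set_def distinct_map)
      then have lc': "length c' = e s"
        using dc lc by (metis distinct_card)
      have "map t c' = replicate (e s) s"
        using c'(1) ts lc' by (intro replicate_eqI) auto
      then have tw: "map t (u @ c' @ v) = map t w"
        using tc by (subst weq) simp
      have "u @ c' @ v \<in> permutations_of_set X"
        using dw c' unfolding weq by (intro permutations_of_setI) auto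
      then have "u @ c' @ v \<in> W"
        using cong[OF w _ tw] by blast
      moreover have "P (u @ c' @ v) = P w" "N (u @ c' @ v) = N w"
        by (simp_all only: P_def N_def tw)
      then have "Dec (u @ c' @ v) u cs' v"
        unfolding Dec_def using lu cs(2) lc' N cs'_c' by simp
      ultimately show ?thesis
        by (simp add: c'_def)
    qed
    show "sym_sum (word_prod \<circ> map f) (set cs) = 0"
    proof (rule zero)
      show "card (set cs) = e s"
        using dc lc by (simp add: cs(1) distinct_card card_image inj_on_def)
      show "(word_prod \<circ> map f) ` set cs \<subseteq> A s"
        using ts f dw(2) weq by (auto simp: cs(1))
    qed simp
  qed
qed

section \<open>Combination of both cases\<close>

text \<open>The orderings of \<open>X\<close> are split into those with a block decomposition and
  the rest, which contain a long run; both partial sums vanish.\<close>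

lemma sym_sum_eq_0_if_alt_products:
  fixes f :: "'x \<Rightarrow> 'r::ring" and e :: "bool \<Rightarrow> nat"
  assumes X: "finite X" "card X = (e True + e False - 2) * (k * e r + 2)"
    and e: "\<And>s. e s > 0" "e True + e False > 2" and k: "k > 0"
    and zero: "\<And>(Y :: 'x list set) g s. finite Y \<Longrightarrow> card Y = e s \<Longrightarrow> g ` Y \<subseteq> A s \<Longrightarrow> sym_sum g Y = 0"
    and f: "\<And>x. x \<in> X \<Longrightarrow> f x \<in> A (t x)"
    and mult: "\<And>s. \<forall>x\<in>A s. \<forall>y\<in>A s. x * y \<in> A s"
    and alt: "alt_products (A True) (A False) k \<subseteq> A r"
  shows "sym_sum f X = 0"
proof -
  let ?P = "permutations_of_set X"
  let ?D = "{w \<in> ?P. \<exists>u cs v. block_dec t k (e r) w u cs v}"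
  have "(\<Sum>w\<in>?D. word_prod (map f w)) = 0"
  proof (rule sum_block_dec_eq_0[OF X(1) k e(1)])
    show "sym_sum g Y = 0" if "finite Y" "card Y = e r" "g ` Y \<subseteq> A r" for Y :: "'x list set" and g
      using that by (rule zero)
    fix c assume c: "set c \<subseteq> X" "block t k c"
    then have "\<forall>x\<in>set c. f x \<in> (if t x then A True else A False)"
      using f by (metis (full_types) subsetD)
    then show "word_prod (map f c) \<in> A r"
      using word_prod_block[OF mult mult _ c(2)] alt by blast
  qed
  moreover have "(\<Sum>w\<in>?P - ?D. word_prod (map f w)) = 0"
  proof (rule sum_long_run_eq_0[where e = e and A = A])
    show "w' \<in> ?P - ?D" if "w \<in> ?P - ?D" "w' \<in> ?P" "map t w' = map t w" for w w'
      using that block_dec_cong_map[of t w' w] by blast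
    show "\<exists>p s. take (e s) (drop p (map t w)) = replicate (e s) s" if w: "w \<in> ?P - ?D" for w
    proof (rule block_dec_or_long_run[OF e(1) e(1) e(2)])
      show "length w = (e True + e False - 2) * (k * e r + 2)"
        unfolding X(2)[symmetric] using w
        by (simp add: length_finite_permutations_of_set)
      show "\<nexists>u cs v. block_dec t k (e r) w u cs v"
        using w by blast
    qed
  qed (use e zero f in auto)
  ultimately show ?thesis
    unfolding sym_sum_def using sum.subset_diff[of ?D ?P "\<lambda>w. word_prod (map f w)"] by simp
qed

theorem corollary2p3:
  fixes scale :: "'f::field \<Rightarrow> 'r::ring \<Rightarrow> 'r"
    and S :: "nat \<Rightarrow> 'r set"
    and d :: "nat \<Rightarrow> nat"
    and k i :: nat
  assumes "CHAR('f) > 0"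
    and "assoc_algebra scale"
    and "subalgebra scale (S 1)" and "subalgebra scale (S 2)"
    and "\<forall>r. \<exists>r1\<in>S 1. \<exists>r2\<in>S 2. r = r1 + r2"
    and "PI_algebra scale (S 1)" and "PI_algebra scale (S 2)"
    and "d 1 > 0" and "d 2 > 0"
    and "satisfies_sym_identity scale (S 1) (d 1)"
    and "satisfies_sym_identity scale (S 2) (d 2)"
    and "k > 0"
    and "i \<in> {1, 2}"
    and "alt_products (S 1) (S 2) k \<subseteq> S i"
  shows "satisfies_sym_identity scale UNIV ((d 1 + d 2 - 2) * (k * d i + 2))"
proof -
  let ?D = "(d 1 + d 2 - 2) * (k * d i + 2)"
  \<comment> \<open>Translates the two letter types into the indices 1 and 2 of the
    subalgebras.\<close>
  define n where "n s = (if s then 1 else 2 :: nat)" for s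
  obtain r where r: "n r = i"
    using assms(13) unfolding n_def by (metis insertE singletonD)
  have ne: "S (n s) \<noteq> {}" for s
    using assms(5) unfolding n_def by auto
  have mult: "\<forall>x\<in>S (n s). \<forall>y\<in>S (n s). x * y \<in> S (n s)" for s
    using assms(3,4) unfolding n_def subalgebra_def by auto
  have sym: "satisfies_sym_identity scale (S (n s)) (d (n s))" for s
    using assms(10,11) by (simp add: n_def)
  have "sym_sum a {..<?D} = 0" for a :: "nat \<Rightarrow> 'r"
  proof (cases "d 1 + d 2 > 2")
    case False
    \<comment> \<open>Here the degree is 0, and the only word is empty, with placeholder value
      0.\<close>
    then show ?thesis by (simp add: sym_sum_def)
  next
    case True
    have "sym_sum f {..<?D} = 0" if f: "\<forall>x\<in>{..<?D}. f x \<in> S 1 \<union> S 2" for f :: "nat \<Rightarrow> 'r"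
    \<comment> \<open>A value in both subalgebras counts as a letter from R_1.\<close>
    proof (rule sym_sum_eq_0_if_alt_products[where e = "\<lambda>s. d (n s)" and A = "\<lambda>s. S (n s)"
          and t = "\<lambda>x. f x \<in> S 1"])
      show "card {..<?D} = (d (n True) + d (n False) - 2) * (k * d (n r) + 2)"
        unfolding r by (simp add: n_def)
      show "sym_sum g Y = 0" if "finite Y" "card Y = d (n s)" "g ` Y \<subseteq> S (n s)"
        for Y :: "nat list set" and g s
        using that sym[of s] by (intro sym_sum_eq_0[OF assms(2) ne]) auto
      show "f x \<in> S (n (f x \<in> S 1))" if "x \<in> {..<?D}" for x
        using f that by (auto simp: n_def)
      show "alt_products (S (n True)) (S (n False)) k \<subseteq> S (n r)"
        using assms(14) unfolding r by (simp add: n_def)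
    qed (use assms(8,9,12) True mult in \<open>auto simp: n_def\<close>)
    from sym_sum_eq_0_if_spanning[OF finite_lessThan assms(5)[rule_format] this]
    show ?thesis .
  qed
  then show ?thesis
    by (simp add: satisfies_sym_identity_iff_sym_sum[OF assms(2)])
qed

end
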